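(* For positive integer $n\ge 3$ and $p,q\in[0,1]$, the expected number of triangles in $\mathbb{G}(n,p\, ; \, \mathbb{H}_{n,q;3})$ is equal to \[ \binom{n}{3}\cdot \left\{ (1-p q)\cdot \left( \mathbb{P}\left(\textit{Bin}\left(n-3,\tfrac{pq}{3}\right)\ge 1\right) \right)^3 + p q \cdot \left( \mathbb{P}\left(\textit{Bin}\left(n-3,\tfrac{pq}{3}\right)\ge 1\right) \right)^2 \right\}. \]
   Context: $\mathbb{H}_{n,q;3}$ is the binomial random 3-uniform hypergraph on $[n]=\{1,\dots,n\}$: each 3-element subset of $[n]$ is included independently with probability $q$. For a hypergraph $\mathcal{H}$ on $[n]$ and $p\in[0,1]$, the random multigraph $\mathbb{G}(n,p\,;\,\mathcal{H})$ is generated as follows: start with the empty graph on vertex set $[n]$; for every $H\in\mathcal{H}$, choose a 2-element subset $\{i,j\}\subset H$ uniformly at random and then add an edge between $i$ and $j$ with probability $p$; all choices and coin flips are mutually independent. $\mathbb{G}(n,p\,;\,\mathbb{H}_{n,q;3})$ is obtained by first sampling $\mathbb{H}_{n,q;3}$ and then, independently, applying this procedure to it. A triangle in a multigraph on $[n]$ is a set $T$ of three vertices such that every pair of vertices of $T$ is joined by at least one edge. $\textit{Bin}(m,r)$ denotes a binomial random variable with $m$ trials and success probability $r$. *)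

theory Defs
  imports "HOL-Probability.Probability"
begin

type_synonym hypergraph = "nat set set"

text \<open>Multigraphs on \<open>{1..n}\<close> are given by their multiset of edges, an edge being a
  two-element set of vertices. The multiplicity of a pair is the number of parallel edges.\<close>

type_synonym multigraph = "nat set multiset"

definition subsets_of_size :: "nat \<Rightarrow> nat set \<Rightarrow> nat set set" where
  "subsets_of_size k A = {S. S \<subseteq> A \<and> card S = k}"

definition random_hypergraph3 :: "nat \<Rightarrow> real \<Rightarrow> hypergraph pmf" where
  "random_hypergraph3 n q =
     map_pmf (\<lambda>b. {H \<in> subsets_of_size 3 {1..n}. b H})
       (Pi_pmf (subsets_of_size 3 {1..n}) False (\<lambda>_. bernoulli_pmf q))"

text \<open>For each hyperedge \<open>H\<close>, independently: the chosen pair, together with the outcome of the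
  coin that decides whether the edge is really added. The value \<open>({}, False)\<close> is the
  dummy value of the product outside the index set \<open>\<H>\<close> and is never used. The definition is
  meant for finite \<open>\<H>\<close> all of whose members are finite with at least two elements.\<close>

definition random_multigraph :: "real \<Rightarrow> hypergraph \<Rightarrow> multigraph pmf" where
  "random_multigraph p \<H> =
     map_pmf (\<lambda>c. image_mset (\<lambda>H. fst (c H)) (mset_set {H \<in> \<H>. snd (c H)}))
       (Pi_pmf \<H> ({}, False)
         (\<lambda>H. pair_pmf (pmf_of_set (subsets_of_size 2 H)) (bernoulli_pmf p)))"

definition random_multigraph_of_hypergraph3 :: "nat \<Rightarrow> real \<Rightarrow> real \<Rightarrow> multigraph pmf" where
  "random_multigraph_of_hypergraph3 n p q =
     bind_pmf (random_hypergraph3 n q) (\<lambda>\<H>. random_multigraph p \<H>)"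

definition triangles :: "nat \<Rightarrow> multigraph \<Rightarrow> nat set set" where
  "triangles n G =
     {T \<in> subsets_of_size 3 {1..n}. \<forall>e \<in> subsets_of_size 2 T. count G e \<ge> 1}"

end

theory Submission
  imports Defs
begin

text \<open>By linearity it suffices to find the probability that a fixed triple \<open>T\<close> is a triangle. For a
  pair \<open>e\<close> in \<open>T\<close>, each of the \<open>n - 3\<close> hyperedges other than \<open>T\<close> that contain \<open>e\<close> produces the edge \<open>e\<close>
  with probability \<open>pq / 3\<close>, and these groups of hyperedges are disjoint for distinct pairs. The
  hyperedge \<open>T\<close> itself produces one of the three edges with probability \<open>pq\<close>, leaving two pairs to
  be covered by the others, and otherwise leaves three.\<close>

section \<open>Probability mass functions\<close>

lemma prob_bind_pmf:
  "measure_pmf.prob (bind_pmf M N) X = measure_pmf.expectation M (\<lambda>x. measure_pmf.prob (N x) X)"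
proof -
  have int: "integrable (measure_pmf M) (\<lambda>x. measure_pmf.prob (N x) X)"
    by (rule measure_pmf.integrable_const_bound[where B = 1]) auto
  have "ennreal (measure_pmf.prob (bind_pmf M N) X)
      = (\<integral>\<^sup>+x. ennreal (measure_pmf.prob (N x) X) \<partial>measure_pmf M)"
    by (simp add: measure_pmf.emeasure_eq_measure[symmetric])
  also have "\<dots> = ennreal (measure_pmf.expectation M (\<lambda>x. measure_pmf.prob (N x) X))"
    by (rule nn_integral_eq_integral[OF int]) simp
  finally show ?thesis
    by (simp add: Bochner_Integration.integral_nonneg)
qed

text \<open>This is conditioning on the coordinate \<open>x\<close>. It is applied in
  \<open>prob_triangle\<close> to split off the outcome of \<open>T\<close> from those of all other
  triples.\<close>

lemma prob_Pi_pmf_insert: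
  assumes "finite A" "x \<notin> A"
  shows "measure_pmf.prob (Pi_pmf (insert x A) dflt p) X =
    measure_pmf.expectation (p x) (\<lambda>y. measure_pmf.prob (Pi_pmf A dflt p) {f. f(x := y) \<in> X})"
  using assms
  by (simp add: Pi_pmf_insert' prob_bind_pmf map_pmf_def[symmetric] vimage_def)

text \<open>The event for \<open>e\<close> depends only on the coordinates in the block
  \<open>A e\<close>. Restrictions of a product-distributed function to disjoint blocks are
  independent, so the probabilities multiply.\<close>

lemma prob_Pi_pmf_hit_blocks:
  assumes "finite S" "finite F"
    and sub: "\<And>e. e \<in> F \<Longrightarrow> A e \<subseteq> S" and disj: "disjoint_family_on A F"
  shows "measure_pmf.prob (Pi_pmf S d D) {f. \<forall>e\<in>F. \<exists>x\<in>A e. f x \<in> B e}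
       = (\<Prod>e\<in>F. measure_pmf.prob (Pi_pmf S d D) {f. \<exists>x\<in>A e. f x \<in> B e})"
proof (cases "F = {}")
  case False
  let ?R = "\<lambda>e f. restrict f (A e)"
  let ?K = "\<lambda>e. {g \<in> space (PiM (A e) (\<lambda>_. count_space UNIV)). \<exists>x\<in>A e. g x \<in> B e}"
  have "prob_space.indep_vars (Pi_pmf S d D) (\<lambda>_. count_space UNIV) (\<lambda>x f. f x) S"
    by (rule indep_vars_Pi_pmf[OF \<open>finite S\<close>])
  then have ind: "prob_space.indep_vars (Pi_pmf S d D) (\<lambda>e. PiM (A e) (\<lambda>_. count_space UNIV)) ?R F"
    using sub disj by (intro prob_space.indep_vars_restrict[OF prob_space_measure_pmf, where X = "\<lambda>x f. f x"]) auto
  \<comment> \<open>The product sigma-algebra need not contain every set of functions. Since the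
    block is finite, \<open>?K e\<close> is a finite union of cylinder sets and hence
    measurable.\<close>
  have meas: "?K e \<in> sets (PiM (A e) (\<lambda>_. count_space UNIV))" if "e \<in> F" for e
  proof -
    have "finite (A e)" using sub[OF that] \<open>finite S\<close> finite_subset by blast
    moreover have "Measurable.pred (PiM (A e) (\<lambda>_. count_space UNIV)) (\<lambda>g. g x \<in> B e)"
      if "x \<in> A e" for x
      by (rule measurable_compose[OF measurable_component_singleton[OF that]]) simp
    ultimately show ?thesis by measurable
  qed
  have vimage: "?R e -` ?K e = {f. \<exists>x\<in>A e. f x \<in> B e}" for e
    by (auto simp: space_PiM)
  have "(\<Inter>e\<in>F. ?R e -` ?K e) = {f. \<forall>e\<in>F. \<exists>x\<in>A e. f x \<in> B e}"
    unfolding vimage by auto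
  then show ?thesis
    using prob_space.indep_varsD_finite[OF prob_space_measure_pmf ind False \<open>finite F\<close> meas]
    by (simp only: vimage space_measure_pmf Int_UNIV_right)
qed simp

text \<open>The complement is a box: every coordinate in \<open>A\<close> avoids \<open>B\<close>,
  with factor \<open>1 - r\<close> each, and coordinates outside \<open>A\<close> are free, with
  factor 1.\<close>

lemma prob_Pi_pmf_hit:
  assumes "finite S" "A \<subseteq> S" and B: "\<And>x. x \<in> A \<Longrightarrow> measure_pmf.prob (D x) B = r"
  shows "measure_pmf.prob (Pi_pmf S d D) {f. \<exists>x\<in>A. f x \<in> B} = 1 - (1 - r) ^ card A"
proof -
  let ?C = "\<lambda>x. if x \<in> A then - B else UNIV"
  have "measure_pmf.prob (Pi_pmf S d D) (- {f. \<exists>x\<in>A. f x \<in> B})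
      = measure_pmf.prob (Pi_pmf S d D) (Pi S ?C)"
    using \<open>A \<subseteq> S\<close> by (intro arg_cong[where f = "measure_pmf.prob _"]) (auto simp: Pi_def)
  also have "\<dots> = (\<Prod>x\<in>S. measure_pmf.prob (D x) (?C x))"
    by (rule measure_Pi_pmf_Pi[OF \<open>finite S\<close>])
  also have "\<dots> = (\<Prod>x\<in>A. measure_pmf.prob (D x) (?C x))"
    using assms by (intro prod.mono_neutral_right) auto
  also have "\<dots> = (\<Prod>x\<in>A. 1 - r)"
    using measure_pmf.prob_compl[of B] B by (intro prod.cong) (auto simp: Compl_eq_Diff_UNIV)
  finally show ?thesis
    using measure_pmf.prob_compl[of "{f. \<exists>x\<in>A. f x \<in> B}" "Pi_pmf S d D"]
    by (simp add: Compl_eq_Diff_UNIV)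
qed

lemma prob_binomial_pmf_ge_1:
  assumes "r \<in> {0..1}"
  shows "measure_pmf.prob (binomial_pmf m r) {k. k \<ge> 1} = 1 - (1 - r) ^ m"
proof -
  have "{k. k \<ge> 1} = UNIV - {0::nat}" by auto
  then show ?thesis
    using measure_pmf.prob_compl[of "{0}" "binomial_pmf m r"] assms
    by (simp add: measure_pmf_single pmf_binomial)
qed

section \<open>The joint law of the hyperedge outcomes\<close>

lemma finite_subsets_of_size [simp]: "finite A \<Longrightarrow> finite (subsets_of_size k A)"
  by (simp add: subsets_of_size_def)

lemma card_subsets_of_size: "finite A \<Longrightarrow> card (subsets_of_size k A) = card A choose k"
  by (simp add: subsets_of_size_def n_subsets)

lemma subsets_of_size_2:
  assumes "card H = 3"
  shows "finite (subsets_of_size 2 H)" "card (subsets_of_size 2 H) = 3" "subsets_of_size 2 H \<noteq> {}"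
proof -
  have "finite H" using assms by (intro card_ge_0_finite) simp
  then show "finite (subsets_of_size 2 H)" "card (subsets_of_size 2 H) = 3"
    using assms by (simp_all add: card_subsets_of_size eval_nat_numeral)
  then show "subsets_of_size 2 H \<noteq> {}" by auto
qed

definition edge_outcome :: "real \<Rightarrow> nat set \<Rightarrow> (nat set \<times> bool) pmf" where
  "edge_outcome p H = pair_pmf (pmf_of_set (subsets_of_size 2 H)) (bernoulli_pmf p)"

text \<open>All randomness attached to one triple: its presence, the chosen pair and the coin of the
  edge. An absent triple gets \<open>({}, False)\<close>, whose flag keeps it from adding an
  edge.\<close>

definition hyperedge_outcome :: "real \<Rightarrow> real \<Rightarrow> nat set \<Rightarrow> (nat set \<times> bool) pmf" where
  "hyperedge_outcome p q H = bind_pmf (bernoulli_pmf q)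
     (\<lambda>b. if b then edge_outcome p H else return_pmf ({}, False))"

definition outcome_multigraph :: "hypergraph \<Rightarrow> (nat set \<Rightarrow> nat set \<times> bool) \<Rightarrow> multigraph" where
  "outcome_multigraph S c = image_mset (\<lambda>H. fst (c H)) (mset_set {H \<in> S. snd (c H)})"

text \<open>The two-stage sampling becomes a single product over all triples, so that independence
  between triples is available directly. Absent triples are padded with the default value, and then
  the presence coins are merged coordinate by coordinate.\<close>

lemma random_multigraph_of_hypergraph3_eq:
  "random_multigraph_of_hypergraph3 n p q = map_pmf (outcome_multigraph (subsets_of_size 3 {1..n}))
     (Pi_pmf (subsets_of_size 3 {1..n}) ({}, False) (hyperedge_outcome p q))"
proof -
  define S where "S = subsets_of_size 3 {1..n}"
  have fin: "finite S" by (simp add: S_def)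
  have *: "random_multigraph p {H \<in> S. b H} = map_pmf (outcome_multigraph S)
      (Pi_pmf S ({}, False) (\<lambda>H. if b H then edge_outcome p H else return_pmf ({}, False)))" for b
  proof -
    have "random_multigraph p {H \<in> S. b H} = map_pmf (outcome_multigraph S)
        (Pi_pmf {H \<in> S. b H} ({}, False) (edge_outcome p))"
      unfolding random_multigraph_def edge_outcome_def[abs_def]
    proof (rule map_pmf_cong[OF refl])
      fix c assume "c \<in> set_pmf (Pi_pmf {H \<in> S. b H} ({}, False)
        (\<lambda>H. pair_pmf (pmf_of_set (subsets_of_size 2 H)) (bernoulli_pmf p)))"
      \<comment> \<open>Outside the sampled hypergraph the default has flag \<open>False\<close>, so
        filtering by the flag selects the same hyperedges from \<open>S\<close>.\<close>
      from subsetD[OF set_Pi_pmf_subset this] fin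
      have "\<forall>H. H \<notin> {H \<in> S. b H} \<longrightarrow> c H = ({}, False)" by simp
      then have "{H \<in> {H \<in> S. b H}. snd (c H)} = {H \<in> S. snd (c H)}" by auto
      then show "image_mset (\<lambda>H. fst (c H)) (mset_set {H \<in> {H \<in> S. b H}. snd (c H)})
          = outcome_multigraph S c"
        by (simp add: outcome_multigraph_def)
    qed
    then show ?thesis by (simp add: Pi_pmf_if_set[OF fin])
  qed
  show ?thesis
    unfolding random_multigraph_of_hypergraph3_def random_hypergraph3_def
      S_def[symmetric] hyperedge_outcome_def[abs_def]
    \<comment> \<open>\<open>d' = False\<close> is the default of the presence bits in
      \<open>random_hypergraph3\<close>.\<close>
    by (simp add: Pi_pmf_bind[OF fin, where d' = False] bind_map_pmf map_bind_pmf *)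
qed

lemma count_outcome_multigraph_ge_1:
  assumes "finite S"
  shows "count (outcome_multigraph S c) e \<ge> 1 \<longleftrightarrow> (\<exists>H\<in>S. c H = (e, True))"
proof -
  have "count (outcome_multigraph S c) e \<ge> 1 \<longleftrightarrow> e \<in># outcome_multigraph S c"
    by (simp add: Suc_le_eq)
  also have "\<dots> \<longleftrightarrow> (\<exists>H\<in>S. c H = (e, True))"
    using assms by (force simp: outcome_multigraph_def prod_eq_iff)
  finally show ?thesis .
qed

lemma set_pmf_hyperedge_outcome:
  assumes "card H = 3" "(e, True) \<in> set_pmf (hyperedge_outcome p q H)"
  shows "e \<in> subsets_of_size 2 H"
  using assms(2) subsets_of_size_2[OF assms(1)]
  by (auto simp: hyperedge_outcome_def edge_outcome_def split: if_splits)

text \<open>Presence contributes \<open>q\<close>, the choice of \<open>e\<close> among the three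
  pairs 1/3, and the coin \<open>p\<close>. The absent branch contributes nothing because its flag
  is \<open>False\<close>.\<close>

lemma prob_hyperedge_outcome:
  assumes "card H = 3" "e \<in> subsets_of_size 2 H" "p \<in> {0..1}" "q \<in> {0..1}"
  shows "measure_pmf.prob (hyperedge_outcome p q H) {(e, True)} = p * q / 3"
  using assms subsets_of_size_2[OF assms(1)]
  by (simp add: hyperedge_outcome_def edge_outcome_def measure_pmf_single pmf_bind pmf_pair)

section \<open>Triangles\<close>

text \<open>Such a triple is \<open>e\<close> together with one further vertex. The third vertex of
  \<open>T\<close> is ruled out because it gives \<open>T\<close> back, which leaves the
  \<open>n - 3\<close> vertices outside \<open>T\<close>.\<close>

lemma card_hyperedges_containing:
  assumes "T \<in> subsets_of_size 3 {1..n}" "e \<in> subsets_of_size 2 T"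
  shows "card {H \<in> subsets_of_size 3 {1..n} - {T}. e \<subseteq> H} = n - 3"
proof -
  have T: "T \<subseteq> {1..n}" "card T = 3" "finite T" and e: "e \<subseteq> T" "card e = 2" "finite e"
    using assms by (auto simp: subsets_of_size_def intro: finite_subset)
  obtain w where w: "T = insert w e" "w \<notin> e"
  proof -
    have "card (T - e) = 1" using T e by (simp add: card_Diff_subset)
    then obtain w where "T - e = {w}" by (rule card_1_singletonE)
    then show ?thesis using e that[of w] by auto
  qed
  have "{H \<in> subsets_of_size 3 {1..n} - {T}. e \<subseteq> H} = (\<lambda>v. insert v e) ` ({1..n} - T)"
  proof (intro equalityI subsetI)
    fix H assume "H \<in> {H \<in> subsets_of_size 3 {1..n} - {T}. e \<subseteq> H}"
    then have H: "H \<subseteq> {1..n}" "card H = 3" "e \<subseteq> H" "H \<noteq> T"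
      by (auto simp: subsets_of_size_def)
    then have "card (H - e) = 1" using e by (simp add: card_Diff_subset)
    then obtain v where "H - e = {v}" by (rule card_1_singletonE)
    with H w have "H = insert v e" "v \<notin> T" "v \<in> {1..n}" by auto
    then show "H \<in> (\<lambda>v. insert v e) ` ({1..n} - T)" by auto
  next
    fix H assume "H \<in> (\<lambda>v. insert v e) ` ({1..n} - T)"
    then obtain v where "v \<in> {1..n}" "v \<notin> T" "v \<notin> e" "H = insert v e"
      using e by blast
    then show "H \<in> {H \<in> subsets_of_size 3 {1..n} - {T}. e \<subseteq> H}"
      using T e by (auto simp: subsets_of_size_def)
  qed
  moreover have "inj_on (\<lambda>v. insert v e) ({1..n} - T)"
    using e by (intro inj_onI) blast
  ultimately show ?thesis
    using T by (simp add: card_image card_Diff_subset)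
qed

text \<open>\<open>Q\<close> is the probability that a fixed pair in \<open>T\<close> is joined by
  an edge coming from a triple other than \<open>T\<close>.\<close>

context
  fixes n :: nat and p q Q :: real and S :: hypergraph and T :: "nat set"
  assumes p: "p \<in> {0..1}" and q: "q \<in> {0..1}"
    and S_def: "S = subsets_of_size 3 {1..n}" and T: "T \<in> S"
    and Q_def: "Q = 1 - (1 - p * q / 3) ^ (n - 3)"
begin

lemma card_hyperedge: "H \<in> S \<Longrightarrow> card H = 3"
  by (simp add: S_def subsets_of_size_def)

text \<open>Two distinct pairs in \<open>T\<close> span \<open>T\<close>, so no other hyperedge contains both of them.\<close>

lemma prob_pairs_covered_outside:
  assumes F: "F \<subseteq> subsets_of_size 2 T"
  shows "measure_pmf.prob (Pi_pmf (S - {T}) ({}, False) (hyperedge_outcome p q))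
           {f. \<forall>e\<in>F. \<exists>H\<in>S - {T}. f H = (e, True)} = Q ^ card F"
proof -
  let ?M = "Pi_pmf (S - {T}) ({}, False) (hyperedge_outcome p q)"
  let ?A = "\<lambda>e. {H \<in> S - {T}. e \<subseteq> H}"
  have fin: "finite (S - {T})" by (simp add: S_def)
  have T3: "card T = 3" using card_hyperedge[OF T] .
  have finF: "finite F" using F subsets_of_size_2(1)[OF T3] by (rule finite_subset)
  have disj: "disjoint_family_on ?A F"
    unfolding disjoint_family_on_def
  proof (intro ballI impI)
    fix d e assume de: "d \<in> F" "e \<in> F" "d \<noteq> e"
    have "H = T" if H: "H \<in> S" "d \<subseteq> H" "e \<subseteq> H" for H
    proof -
      have finT: "finite T" using T3 by (intro card_ge_0_finite) simp
      have d: "d \<subseteq> T" "card d = 2" and e: "e \<subseteq> T" "card e = 2"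
        using de F by (auto simp: subsets_of_size_def)
      \<comment> \<open>Inclusion between sets of size 2 would force equality. Hence the union has
        more than two elements and fills \<open>T\<close>.\<close>
      have "\<not> e \<subseteq> d"
        using de(3) d e finT by (metis card_subset_eq finite_subset)
      then have "card d < card (d \<union> e)"
        using d e finT by (intro psubset_card_mono) (auto intro: finite_subset)
      then have "d \<union> e = T"
        using d e finT T3 card_mono[of T "d \<union> e"] by (intro card_subset_eq) auto
      then have "T \<subseteq> H" using H by blast
      moreover have "card T = card H" using T3 card_hyperedge[OF H(1)] by simp
      moreover have "finite H" using card_hyperedge[OF H(1)] by (intro card_ge_0_finite) simp
      ultimately show ?thesis by (metis card_subset_eq)
    qed
    then show "?A d \<inter> ?A e = {}" by blast
  qed
  \<comment> \<open>The two events agree only on the support: there, a triple can produce only pairs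
    that it contains, so the search for \<open>H\<close> may be confined to the block
    \<open>?A e\<close>.\<close>
  have "measure_pmf.prob ?M {f. \<forall>e\<in>F. \<exists>H\<in>S - {T}. f H = (e, True)}
      = measure_pmf.prob ?M {f. \<forall>e\<in>F. \<exists>H\<in>?A e. f H \<in> {(e, True)}}"
  proof (rule measure_pmf.finite_measure_eq_AE)
    have "(\<exists>H\<in>S - {T}. f H = (e, True)) \<longleftrightarrow> (\<exists>H\<in>?A e. f H \<in> {(e, True)})"
      if "f \<in> set_pmf ?M" for f e
    proof -
      have "e \<subseteq> H" if H: "H \<in> S - {T}" "f H = (e, True)" for H
      proof -
        have "f H \<in> set_pmf (hyperedge_outcome p q H)"
          using H(1) \<open>f \<in> set_pmf ?M\<close> by (simp add: set_Pi_pmf[OF fin] PiE_dflt_def)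
        then have "e \<in> subsets_of_size 2 H"
          using H card_hyperedge set_pmf_hyperedge_outcome by simp
        then show ?thesis by (simp add: subsets_of_size_def)
      qed
      then show ?thesis by blast
    qed
    then show "AE f in measure_pmf ?M. f \<in> {f. \<forall>e\<in>F. \<exists>H\<in>S - {T}. f H = (e, True)} \<longleftrightarrow>
        f \<in> {f. \<forall>e\<in>F. \<exists>H\<in>?A e. f H \<in> {(e, True)}}"
      by (intro AE_pmfI) (simp only: mem_Collect_eq)
  qed auto
  also have "\<dots> = (\<Prod>e\<in>F. measure_pmf.prob ?M {f. \<exists>H\<in>?A e. f H \<in> {(e, True)}})"
    by (rule prob_Pi_pmf_hit_blocks[OF fin finF _ disj]) auto
  also have "\<dots> = (\<Prod>e\<in>F. Q)"
  proof (rule prod.cong[OF refl])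
    fix e assume "e \<in> F"
    then have e: "e \<in> subsets_of_size 2 T" using F by auto
    have "measure_pmf.prob ?M {f. \<exists>H\<in>?A e. f H \<in> {(e, True)}} = 1 - (1 - p * q / 3) ^ card (?A e)"
    proof (rule prob_Pi_pmf_hit[OF fin])
      fix H assume "H \<in> ?A e"
      then show "measure_pmf.prob (hyperedge_outcome p q H) {(e, True)} = p * q / 3"
        using e p q by (intro prob_hyperedge_outcome card_hyperedge) (auto simp: subsets_of_size_def)
    qed auto
    then show "measure_pmf.prob ?M {f. \<exists>H\<in>?A e. f H \<in> {(e, True)}} = Q"
      using card_hyperedges_containing[OF T[unfolded S_def] e] by (simp add: Q_def S_def)
  qed
  finally show ?thesis by simp
qed

lemma prob_triangle:
  "measure_pmf.prob (Pi_pmf S ({}, False) (hyperedge_outcome p q))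
     {c. \<forall>e\<in>subsets_of_size 2 T. \<exists>H\<in>S. c H = (e, True)} = (1 - p * q) * Q ^ 3 + p * q * Q ^ 2"
proof -
  let ?E = "subsets_of_size 2 T" and ?D = "hyperedge_outcome p q T"
  let ?Y = "\<Union>e\<in>?E. {(e, True)}"
  let ?X = "{c. \<forall>e\<in>?E. \<exists>H\<in>S. c H = (e, True)}"
  have T3: "card T = 3" using card_hyperedge[OF T] .
  note E = subsets_of_size_2[OF T3]
  have fin: "finite (S - {T})" by (simp add: S_def)
  \<comment> \<open>\<open>?Y\<close> is the set of outcomes in which \<open>T\<close> itself yields
    an edge. Writing the conditional probability as an affine function of its indicator reduces the
    expectation to the probability of \<open>?Y\<close>.\<close>
  have inner: "measure_pmf.prob (Pi_pmf (S - {T}) ({}, False) (hyperedge_outcome p q))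
      {f. f(T := y) \<in> ?X} = Q ^ 3 + (Q ^ 2 - Q ^ 3) * indicator ?Y y" for y
  proof -
    have "{f. f(T := y) \<in> ?X}
        = {f. \<forall>e\<in>{e \<in> ?E. y \<noteq> (e, True)}. \<exists>H\<in>S - {T}. f H = (e, True)}"
      using T by (auto simp: fun_upd_def)
    \<comment> \<open>A single outcome \<open>y\<close> covers at most one pair, so two or three
      pairs remain for the other triples.\<close>
    moreover have "card {e \<in> ?E. y \<noteq> (e, True)} = (if y \<in> ?Y then 2 else 3)"
    proof (cases "y \<in> ?Y")
      case True
      then obtain e where "e \<in> ?E" "y = (e, True)" by auto
      moreover from this have "{e \<in> ?E. y \<noteq> (e, True)} = ?E - {e}" by auto
      ultimately show ?thesis using True E by simp
    next
      case False
      then have "{e \<in> ?E. y \<noteq> (e, True)} = ?E" by auto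
      then show ?thesis using False E by simp
    qed
    ultimately show ?thesis
      using prob_pairs_covered_outside[of "{e \<in> ?E. y \<noteq> (e, True)}"] by simp
  qed
  \<comment> \<open>Three disjoint outcomes of probability \<open>p * q / 3\<close> each.\<close>
  have "measure_pmf.prob ?D ?Y = (\<Sum>e\<in>?E. measure_pmf.prob ?D {(e, True)})"
    using E by (intro measure_pmf.finite_measure_finite_Union) (auto simp: disjoint_family_on_def)
  also have "\<dots> = p * q"
    using E by (simp add: prob_hyperedge_outcome[OF T3 _ p q] del: atLeastAtMost_iff)
  finally have Y: "measure_pmf.prob ?D ?Y = p * q" .
  have "measure_pmf.prob (Pi_pmf S ({}, False) (hyperedge_outcome p q)) ?X
      = measure_pmf.expectation ?D (\<lambda>y. Q ^ 3 + (Q ^ 2 - Q ^ 3) * indicator ?Y y)"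
    using prob_Pi_pmf_insert[OF fin, of T "({}, False)" "hyperedge_outcome p q" ?X]
    by (simp only: insert_Diff[OF T] inner) simp
  also have "\<dots> = Q ^ 3 + (Q ^ 2 - Q ^ 3) * measure_pmf.prob ?D ?Y"
  proof -
    have "integrable (measure_pmf ?D) (indicat_real ?Y)"
      by (rule measure_pmf.integrable_const_bound[where B = 1]) auto
    then show ?thesis by (subst Bochner_Integration.integral_add) simp_all
  qed
  finally show ?thesis by (simp add: Y algebra_simps)
qed

end

theorem theorem1p9:
  fixes n :: nat and p q :: real
  assumes "n \<ge> 3" and "p \<in> {0..1}" and "q \<in> {0..1}"
  shows "measure_pmf.expectation (random_multigraph_of_hypergraph3 n p q)
           (\<lambda>G. real (card (triangles n G))) =
         real (n choose 3) *
           ((1 - p * q) * (measure_pmf.prob (binomial_pmf (n - 3) (p * q / 3)) {k. k \<ge> 1}) ^ 3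
            + p * q * (measure_pmf.prob (binomial_pmf (n - 3) (p * q / 3)) {k. k \<ge> 1}) ^ 2)"
proof -
  define S where "S = subsets_of_size 3 {1..n}"
  define Q where "Q = measure_pmf.prob (binomial_pmf (n - 3) (p * q / 3)) {k. k \<ge> 1}"
  let ?M = "Pi_pmf S ({}, False) (hyperedge_outcome p q)"
  let ?X = "\<lambda>T. {c. \<forall>e\<in>subsets_of_size 2 T. \<exists>H\<in>S. c H = (e, True)}"
  have fin: "finite S" by (simp add: S_def)
  \<comment> \<open>The closed form of the binomial tail requires a success probability in the unit
    interval.\<close>
  have "p * q \<le> 1 * 1" using assms by (intro mult_mono) auto
  then have "p * q / 3 \<in> {0..1}" using assms by simp
  then have Q: "Q = 1 - (1 - p * q / 3) ^ (n - 3)"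
    unfolding Q_def by (rule prob_binomial_pmf_ge_1)
  \<comment> \<open>Pointwise, the number of triangles is a sum of indicators over all triples,
    which prepares linearity of expectation.\<close>
  have card: "real (card (triangles n (outcome_multigraph S c))) = (\<Sum>T\<in>S. indicator (?X T) c)" for c
  proof -
    have "triangles n (outcome_multigraph S c) = {T \<in> S. c \<in> ?X T}"
      by (simp only: triangles_def count_outcome_multigraph_ge_1[OF fin] S_def[symmetric] mem_Collect_eq)
    then show ?thesis
      using fin by (simp add: indicator_def sum.If_cases Int_def)
  qed
  have "measure_pmf.expectation (random_multigraph_of_hypergraph3 n p q)
      (\<lambda>G. real (card (triangles n G))) = measure_pmf.expectation ?M (\<lambda>c. \<Sum>T\<in>S. indicator (?X T) c)"
    by (simp only: random_multigraph_of_hypergraph3_eq S_def[symmetric] integral_map_pmf card)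
  also have "\<dots> = (\<Sum>T\<in>S. measure_pmf.prob ?M (?X T))"
    by (subst Bochner_Integration.integral_sum)
       (auto intro: measure_pmf.integrable_const_bound[where B = 1])
  also have "\<dots> = (\<Sum>T\<in>S. (1 - p * q) * Q ^ 3 + p * q * Q ^ 2)"
    using prob_triangle[OF assms(2,3) S_def _ Q] by (intro sum.cong) simp_all
  also have "\<dots> = real (n choose 3) * ((1 - p * q) * Q ^ 3 + p * q * Q ^ 2)"
    by (simp add: S_def card_subsets_of_size)
  finally show ?thesis by (simp only: Q_def)
qed

end
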